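(* Let $X$ be a complete uniform space whose uniformity is generated by a saturated family of pseudometrics $\{d_\lambda\}_{\lambda\in\Lambda}$. For each $\lambda\in\Lambda$, let $\varphi_\lambda:X\to\mathbb{R}$ be a lower semi-continuous and bounded below function. Then, for each $x_0\in X$, there exists $x^*\in X$ such that the following two conditions hold: (1) for any $\lambda\in\Lambda$, $\varphi_\lambda(x^* )+d_\lambda(x_0,x^* )\le\varphi_\lambda(x_0)$; and (2) for each $x\in X$ with $x\neq x^*$, there exists $\mu\in\Lambda$ satisfying $\varphi_\mu(x^* )<\varphi_\mu(x)+d_\mu(x,x^* )$.
   Context: $X$ carries the topology induced by its uniformity. Complete means that every Cauchy filter base in $X$ converges, where a filter base is Cauchy if for each $\lambda\in\Lambda$ and $\epsilon>0$ it contains a set $A$ with $d_\lambda(x,y)<\epsilon$ for all $x,y\in A$. The family $\{d_\lambda\}_{\lambda\in\Lambda}$ is saturated if for all $\lambda,\mu\in\Lambda$ there is $\nu\in\Lambda$ with $\max\{d_\lambda(x,y),d_\mu(x,y)\}\le d_\nu(x,y)$ for all $x,y\in X$.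
   Formalization: The uniform space X is additionally assumed to be Hausdorff; without this the claim fails, e.g. for two points with the single pseudometric d = 0 and φ = 0, where condition (2) would read 0 < 0. *)

theory Defs
  imports "HOL-Analysis.Analysis"
begin

definition pseudometric :: "('a \<Rightarrow> 'a \<Rightarrow> real) \<Rightarrow> bool" where
  "pseudometric d \<longleftrightarrow>
     (\<forall>x y. 0 \<le> d x y) \<and> (\<forall>x. d x x = 0) \<and> (\<forall>x y. d x y = d y x) \<and>
     (\<forall>x y z. d x z \<le> d x y + d y z)"

definition saturated_family :: "'i set \<Rightarrow> ('i \<Rightarrow> 'a \<Rightarrow> 'a \<Rightarrow> real) \<Rightarrow> bool" where
  "saturated_family \<Lambda> d \<longleftrightarrow>
     (\<forall>l\<in>\<Lambda>. \<forall>m\<in>\<Lambda>. \<exists>n\<in>\<Lambda>. \<forall>x y. max (d l x y) (d m x y) \<le> d n x y)"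

(* The infimum of filters is the coarsest one containing all sets {(x, y). d l x y < e}: the
   entourages are exactly the supersets of finite intersections of such sets.
   Nothing here makes the family separate points; the theorem assumes the space to be Hausdorff
   through the class t2_space. Without that it fails: on two points with d = 0 and constant
   functions, the strict inequality in its second condition reads 0 < 0. *)
definition generates_uniformity ::
    "'i set \<Rightarrow> ('i \<Rightarrow> 'a::uniform_space \<Rightarrow> 'a \<Rightarrow> real) \<Rightarrow> bool" where
  "generates_uniformity \<Lambda> d \<longleftrightarrow>
     (uniformity :: ('a \<times> 'a) filter) =
       (INF l\<in>\<Lambda>. INF e\<in>{0<..}. principal {(x, y). d l x y < e})"

definition lower_semicontinuous :: "('a::topological_space \<Rightarrow> real) \<Rightarrow> bool" where
  "lower_semicontinuous f \<longleftrightarrow> (\<forall>a. open {x. a < f x})"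

(* Completeness is the library's constant complete, which speaks about Cauchy filters. For a
   uniformity generated by pseudometrics it agrees with convergence of all Cauchy filter bases. *)
lemma complete_iff_cauchy_filter_bases:
  fixes d :: "'i \<Rightarrow> 'a::uniform_space \<Rightarrow> 'a \<Rightarrow> real"
  assumes gen: "generates_uniformity \<Lambda> d"
  shows "complete (UNIV :: 'a set) \<longleftrightarrow>
    (\<forall>B. B \<noteq> {} \<and> {} \<notin> B \<and> (\<forall>A\<in>B. \<forall>A'\<in>B. \<exists>C\<in>B. C \<subseteq> A \<inter> A') \<and>
         (\<forall>l\<in>\<Lambda>. \<forall>e>0. \<exists>A\<in>B. \<forall>x\<in>A. \<forall>y\<in>A. d l x y < e)
       \<longrightarrow> (\<exists>x. \<forall>U. open U \<and> x \<in> U \<longrightarrow> (\<exists>A\<in>B. A \<subseteq> U)))"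
  (is "_ \<longleftrightarrow> (\<forall>B. ?base B \<longrightarrow> ?conv B)")
proof
  have cauchy: "cauchy_filter F \<longleftrightarrow>
      (\<forall>l\<in>\<Lambda>. \<forall>e>0. \<exists>Q. eventually Q F \<and> (\<forall>x y. Q x \<longrightarrow> Q y \<longrightarrow> d l x y < e))"
    for F :: "'a filter"
  proof -
    have "cauchy_filter F \<longleftrightarrow>
        (\<forall>l\<in>\<Lambda>. \<forall>e\<in>{0<..}. F \<times>\<^sub>F F \<le> principal {(x, y). d l x y < e})"
      by (subst cauchy_filter_def, subst gen[unfolded generates_uniformity_def],
          subst le_INF_iff, subst le_INF_iff, rule refl)
    then show ?thesis
      by (simp only: le_principal eventually_prod_same mem_Collect_eq case_prod_conv
          greaterThan_iff Ball_def)
  qed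
  {
    assume compl: "complete (UNIV :: 'a set)"
    show "\<forall>B. ?base B \<longrightarrow> ?conv B"
    proof (intro allI impI)
      fix B :: "'a set set"
      assume B: "?base B"
      define F where "F = (INF A\<in>B. principal A)"
      have ev: "eventually P F \<longleftrightarrow> (\<exists>A\<in>B. \<forall>x\<in>A. P x)" for P
        unfolding F_def using B
        by (subst eventually_INF_base) (auto simp: eventually_principal)
      have "F \<noteq> bot"
        using B by (auto simp: trivial_limit_def ev)
      moreover have "cauchy_filter F"
        unfolding cauchy
      proof (intro ballI allI impI)
        fix l and e :: real
        assume "l \<in> \<Lambda>" "0 < e"
        with B obtain A where "A \<in> B" "\<forall>x\<in>A. \<forall>y\<in>A. d l x y < e" by meson
        then show "\<exists>Q. eventually Q F \<and> (\<forall>x y. Q x \<longrightarrow> Q y \<longrightarrow> d l x y < e)"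
          by (intro exI[of _ "\<lambda>x. x \<in> A"]) (auto simp: ev)
      qed
      ultimately obtain x where "F \<le> nhds x"
        using compl by (auto simp: complete_uniform)
      then have "eventually (\<lambda>y. y \<in> U) F" if "open U" "x \<in> U" for U
        using that eventually_nhds_in_open[of U x] by (auto simp: le_filter_def)
      then show "?conv B"
        unfolding ev by (metis subsetI)
    qed
  next
    assume bases: "\<forall>B. ?base B \<longrightarrow> ?conv B"
    show "complete (UNIV :: 'a set)"
      unfolding complete_uniform
    proof (intro allI impI)
      fix F :: "'a filter"
      assume F: "F \<noteq> bot" "cauchy_filter F"
      define B where "B = {A. eventually (\<lambda>x. x \<in> A) F}"
      have "UNIV \<in> B" "{} \<notin> B"
        using F(1) by (auto simp: B_def trivial_limit_def)
      moreover have "\<forall>A\<in>B. \<forall>A'\<in>B. \<exists>C\<in>B. C \<subseteq> A \<inter> A'"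
      proof (intro ballI)
        fix A A'
        assume "A \<in> B" "A' \<in> B"
        then have "A \<inter> A' \<in> B" by (simp add: B_def eventually_conj)
        then show "\<exists>C\<in>B. C \<subseteq> A \<inter> A'" by blast
      qed
      moreover have "\<forall>l\<in>\<Lambda>. \<forall>e>0. \<exists>A\<in>B. \<forall>x\<in>A. \<forall>y\<in>A. d l x y < e"
      proof (intro ballI allI impI)
        fix l and e :: real
        assume "l \<in> \<Lambda>" "0 < e"
        with F(2) obtain Q where "eventually Q F" "\<forall>x y. Q x \<longrightarrow> Q y \<longrightarrow> d l x y < e"
          unfolding cauchy by meson
        then show "\<exists>A\<in>B. \<forall>x\<in>A. \<forall>y\<in>A. d l x y < e"
          by (intro bexI[of _ "{x. Q x}"]) (auto simp: B_def)
      qed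
      ultimately have "?base B" by blast
      with bases[THEN spec[of _ B]] have "?conv B" by (rule mp)
      then obtain x where x: "\<forall>U. open U \<and> x \<in> U \<longrightarrow> (\<exists>A\<in>B. A \<subseteq> U)" ..
      have "F \<le> nhds x"
      proof (rule filter_leI)
        fix P
        assume "eventually P (nhds x)"
        then obtain U where U: "open U" "x \<in> U" "\<forall>y\<in>U. P y" by (auto simp: eventually_nhds)
        from x have "open U \<and> x \<in> U \<longrightarrow> (\<exists>A\<in>B. A \<subseteq> U)" ..
        with U(1,2) obtain A where "A \<in> B" "A \<subseteq> U" by auto
        with U(3) have "A \<in> B" "\<forall>y\<in>A. P y" by auto
        then show "eventually P F" by (auto simp: B_def elim: eventually_mono)
      qed
      then show "\<exists>x\<in>UNIV. F \<le> nhds x" by blast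
    qed
  }
qed

end

theory Submission
  imports Defs
begin

text \<open>
  Order the space by letting y lie above x when \<open>\<phi> l y + d l x y \<le> \<phi> l x\<close> for all indices l at once
  (Bishop--Phelps, Broendsted). Along a chain every \<open>\<phi> l\<close> decreases and is bounded below, and it
  controls \<open>d l\<close>, so the tails of the chain form a Cauchy filter base; by lower semicontinuity
  its limit is an upper bound. Zorn's lemma above \<open>x0\<close> yields the required point.
\<close>

definition caristi_le :: "'i set \<Rightarrow> ('i \<Rightarrow> 'a \<Rightarrow> 'a \<Rightarrow> real) \<Rightarrow> ('i \<Rightarrow> 'a \<Rightarrow> real) \<Rightarrow> 'a \<Rightarrow> 'a \<Rightarrow> bool" where
  "caristi_le \<Lambda> d \<phi> x y \<longleftrightarrow> (\<forall>l\<in>\<Lambda>. \<phi> l y + d l x y \<le> \<phi> l x)"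

lemma caristi_leD: "caristi_le \<Lambda> d \<phi> x y \<Longrightarrow> l \<in> \<Lambda> \<Longrightarrow> \<phi> l y + d l x y \<le> \<phi> l x"
  by (simp add: caristi_le_def)

lemma pseudometricD:
  assumes "pseudometric d"
  shows "0 \<le> d x y" and "d x x = 0" and "d x y = d y x" and "d x z \<le> d x y + d y z"
  using assms by (auto simp: pseudometric_def)

lemma caristi_le_refl:
  assumes "\<And>l. l \<in> \<Lambda> \<Longrightarrow> pseudometric (d l)"
  shows "caristi_le \<Lambda> d \<phi> x x"
  using pseudometricD(2)[OF assms] by (simp add: caristi_le_def)

lemma caristi_le_trans:
  assumes pm: "\<And>l. l \<in> \<Lambda> \<Longrightarrow> pseudometric (d l)"
    and xy: "caristi_le \<Lambda> d \<phi> x y" and yz: "caristi_le \<Lambda> d \<phi> y z"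
  shows "caristi_le \<Lambda> d \<phi> x z"
  unfolding caristi_le_def
proof
  fix l assume l: "l \<in> \<Lambda>"
  show "\<phi> l z + d l x z \<le> \<phi> l x"
    using caristi_leD[OF xy l] caristi_leD[OF yz l] pseudometricD(4)[OF pm[OF l], of x z y]
    by linarith
qed

text \<open>A pair at distance zero for every index lies in all generating sets, hence in every
  entourage; an open set around \<open>x\<close> that omits \<open>y\<close> yields an entourage
  without \<open>(x, y)\<close>.\<close>

lemma generates_uniformity_separates:
  fixes d :: "'i \<Rightarrow> 'a::{uniform_space, t2_space} \<Rightarrow> 'a \<Rightarrow> real"
  assumes gen: "generates_uniformity \<Lambda> d" and zero: "\<And>l. l \<in> \<Lambda> \<Longrightarrow> d l x y = 0"
  shows "x = y"
proof (rule ccontr)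
  assume "x \<noteq> y"
  then obtain U where U: "open U" "x \<in> U" "y \<notin> U"
    using t1_space by blast
  have "principal {(x, y)} \<le> (uniformity :: ('a \<times> 'a) filter)"
    unfolding gen[unfolded generates_uniformity_def] using zero
    by (intro INF_greatest) auto
  moreover have "eventually (\<lambda>(x', z). x' = x \<longrightarrow> z \<in> U) uniformity"
    using U(1,2) by (simp add: open_uniformity)
  ultimately have "eventually (\<lambda>(x', z). x' = x \<longrightarrow> z \<in> U) (principal {(x, y)})"
    by (rule filter_leD)
  with U(3) show False
    by (simp add: eventually_principal)
qed

text \<open>Adding the two inequalities cancels the values of \<open>\<phi> l\<close> and leaves
  \<open>d l x y + d l y x \<le> 0\<close>. Separation of points by the family then turns vanishing
  distances into equality.\<close>

lemma caristi_le_antisym: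
  fixes d :: "'i \<Rightarrow> 'a::{uniform_space, t2_space} \<Rightarrow> 'a \<Rightarrow> real"
  assumes pm: "\<And>l. l \<in> \<Lambda> \<Longrightarrow> pseudometric (d l)" and gen: "generates_uniformity \<Lambda> d"
    and xy: "caristi_le \<Lambda> d \<phi> x y" and yx: "caristi_le \<Lambda> d \<phi> y x"
  shows "x = y"
proof (rule generates_uniformity_separates[OF gen])
  fix l assume l: "l \<in> \<Lambda>"
  show "d l x y = 0"
    using caristi_leD[OF xy l] caristi_leD[OF yx l]
      pseudometricD(1)[OF pm[OF l], of x y] pseudometricD(1)[OF pm[OF l], of y x]
    by linarith
qed

lemma eventually_nhds_pseudometric:
  fixes d :: "'i \<Rightarrow> 'a::uniform_space \<Rightarrow> 'a \<Rightarrow> real"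
  assumes gen: "generates_uniformity \<Lambda> d" and l: "l \<in> \<Lambda>" and e: "0 < e"
  shows "\<forall>\<^sub>F z in nhds u. d l u z < e"
proof -
  have "(uniformity :: ('a \<times> 'a) filter) \<le> principal {(x, y). d l x y < e}"
    unfolding gen[unfolded generates_uniformity_def] using l e
    by (intro INF_lower2[of l] INF_lower2[of e]) auto
  then have "\<forall>\<^sub>F (x, y) in uniformity. d l x y < e"
    by (simp add: le_principal case_prod_unfold)
  then show ?thesis
    unfolding eventually_nhds_uniformity by (rule eventually_mono) auto
qed

lemma caristi_chain_ub:
  fixes d :: "'i \<Rightarrow> 'a::uniform_space \<Rightarrow> 'a \<Rightarrow> real"
  assumes compl: "complete (UNIV :: 'a set)"
    and pm: "\<And>l. l \<in> \<Lambda> \<Longrightarrow> pseudometric (d l)"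
    and gen: "generates_uniformity \<Lambda> d"
    and lsc: "\<And>l. l \<in> \<Lambda> \<Longrightarrow> lower_semicontinuous (\<phi> l)"
    and bdd: "\<And>l. l \<in> \<Lambda> \<Longrightarrow> bdd_below (range (\<phi> l))"
    and ne: "C \<noteq> {}"
    and chain: "\<And>x y. x \<in> C \<Longrightarrow> y \<in> C \<Longrightarrow> caristi_le \<Lambda> d \<phi> x y \<or> caristi_le \<Lambda> d \<phi> y x"
  obtains u where "\<And>x. x \<in> C \<Longrightarrow> caristi_le \<Lambda> d \<phi> x u"
proof -
  let ?le = "caristi_le \<Lambda> d \<phi>"
  \<comment> \<open>The tails of the chain, which shrink as \<open>x\<close> moves up; they will
    form the Cauchy filter base.\<close>
  define T where "T x = {y \<in> C. ?le x y}" for x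
  note refl = caristi_le_refl[of \<Lambda> d, OF pm]
  note trans = caristi_le_trans[of \<Lambda> d, OF pm]
  have T_self: "x \<in> T x" if "x \<in> C" for x
    using that refl by (simp add: T_def)
  have T_anti: "T y \<subseteq> T x" if "?le x y" for x y
    using that trans by (auto simp: T_def)
  \<comment> \<open>Of two comparable points, the upper one has the smaller tail, so it can serve as
    \<open>z\<close>.\<close>
  have directed: "\<exists>z\<in>C. T z \<subseteq> T x \<inter> T y" if "x \<in> C" "y \<in> C" for x y
    using chain[OF that] T_anti that by (metis Int_greatest order_refl)
  have cauchy: "\<exists>x\<in>C. \<forall>y\<in>T x. \<forall>z\<in>T x. d l y z < e" if l: "l \<in> \<Lambda>" and e: "0 < e" for l e
  proof -
    have bb: "bdd_below (\<phi> l ` C)"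
      using bdd[OF l] by (rule bdd_below_mono) auto
    \<comment> \<open>Choose \<open>x\<close> so far up the chain that \<open>\<phi> l x\<close> is
      within \<open>e\<close> of the infimum over \<open>C\<close>. On \<open>T x\<close> all values
      of \<open>\<phi> l\<close> are then caught between that infimum and
      \<open>\<phi> l x\<close>.\<close>
    obtain x where x: "x \<in> C" "\<phi> l x < (INF c\<in>C. \<phi> l c) + e"
      using cINF_less_iff[OF ne bb, of "(INF c\<in>C. \<phi> l c) + e"] e by auto
    have "d l y z < e" if y: "y \<in> T x" and z: "z \<in> T x" for y z
    proof -
      have above: "(INF c\<in>C. \<phi> l c) \<le> \<phi> l w" "\<phi> l w \<le> \<phi> l x" if "w \<in> T x" for w
      proof -
        from that have w: "w \<in> C" "?le x w" by (auto simp: T_def)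
        show "(INF c\<in>C. \<phi> l c) \<le> \<phi> l w" using bb w(1) by (rule cINF_lower)
        show "\<phi> l w \<le> \<phi> l x"
          using caristi_leD[OF w(2) l] pseudometricD(1)[OF pm[OF l], of x w] by linarith
      qed
      have "?le y z \<or> ?le z y"
        using chain y z by (auto simp: T_def)
      \<comment> \<open>Whichever of the two points is the upper one, the order bounds their
        distance by the drop of \<open>\<phi> l\<close> between them.\<close>
      then have "d l y z \<le> \<bar>\<phi> l y - \<phi> l z\<bar>"
        using caristi_leD[OF _ l, of d \<phi> y z] caristi_leD[OF _ l, of d \<phi> z y]
          pseudometricD(3)[OF pm[OF l], of y z] by force
      with above[OF y] above[OF z] x(2) show ?thesis by linarith
    qed
    with x(1) show ?thesis by blast
  qed
  have "T ` C \<noteq> {} \<and> {} \<notin> T ` C \<and>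
      (\<forall>A\<in>T ` C. \<forall>A'\<in>T ` C. \<exists>D\<in>T ` C. D \<subseteq> A \<inter> A') \<and>
      (\<forall>l\<in>\<Lambda>. \<forall>e>0. \<exists>A\<in>T ` C. \<forall>x\<in>A. \<forall>y\<in>A. d l x y < e)"
    using ne T_self directed cauchy by (simp add: image_iff) blast
  with complete_iff_cauchy_filter_bases[OF gen, THEN iffD1, OF compl, rule_format, of "T ` C"]
  obtain u where u: "\<And>U. open U \<Longrightarrow> u \<in> U \<Longrightarrow> \<exists>x\<in>C. T x \<subseteq> U"
    by auto
  have "?le x u" if x: "x \<in> C" for x
    unfolding caristi_le_def
  proof
    fix l assume l: "l \<in> \<Lambda>"
    \<comment> \<open>One half of \<open>e\<close> pays for the loss in lower semicontinuity at
      \<open>u\<close>, the other for the distance from \<open>u\<close> to a nearby point of the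
      chain.\<close>
    show "\<phi> l u + d l x u \<le> \<phi> l x"
    proof (rule field_le_epsilon)
      fix e :: real assume "0 < e"
      then have e: "0 < e / 2" by simp
      obtain W where W: "open W" "u \<in> W" "\<And>z. z \<in> W \<Longrightarrow> d l u z < e / 2"
        using eventually_nhds_pseudometric[OF gen l e, of u] by (auto simp: eventually_nhds)
      have "open (W \<inter> {z. \<phi> l u - e / 2 < \<phi> l z})"
        using W(1) lsc[OF l] by (auto simp: lower_semicontinuous_def)
      then obtain y where y: "y \<in> C" "T y \<subseteq> W \<inter> {z. \<phi> l u - e / 2 < \<phi> l z}"
        using u W(2) e by fastforce
      \<comment> \<open>Lying in \<open>T x\<close> places \<open>z\<close> above \<open>x\<close>;
        lying in \<open>T y\<close> makes it close to \<open>u\<close> with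
        \<open>\<phi> l z\<close> not far below \<open>\<phi> l u\<close>.\<close>
      obtain z where z: "z \<in> T x" "z \<in> T y"
        using directed[OF x y(1)] T_self by blast
      have "\<phi> l z + d l x z \<le> \<phi> l x"
        using z(1) l by (auto simp: T_def dest: caristi_leD)
      moreover have "\<phi> l u - e / 2 < \<phi> l z" "d l u z < e / 2"
        using z(2) y(2) W(3) by auto
      moreover have "d l x u \<le> d l x z + d l u z"
        using pseudometricD(3)[OF pm[OF l], of u z] pseudometricD(4)[OF pm[OF l], of x u z]
        by simp
      ultimately show "\<phi> l u + d l x u \<le> \<phi> l x + e" by linarith
    qed
  qed
  then show ?thesis by (rule that)
qed

theorem theorem16:
  fixes \<Lambda> :: "'i set"
    and d :: "'i \<Rightarrow> 'a::{uniform_space, t2_space} \<Rightarrow> 'a \<Rightarrow> real"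
    and \<phi> :: "'i \<Rightarrow> 'a \<Rightarrow> real"
    and x0 :: 'a
  assumes "complete (UNIV :: 'a set)"
    and "\<And>l. l \<in> \<Lambda> \<Longrightarrow> pseudometric (d l)"
    and "saturated_family \<Lambda> d"
    and "generates_uniformity \<Lambda> d"
    and "\<And>l. l \<in> \<Lambda> \<Longrightarrow> lower_semicontinuous (\<phi> l)"
    and "\<And>l. l \<in> \<Lambda> \<Longrightarrow> bdd_below (range (\<phi> l))"
  shows "\<exists>xs. (\<forall>l\<in>\<Lambda>. \<phi> l xs + d l x0 xs \<le> \<phi> l x0) \<and>
              (\<forall>x. x \<noteq> xs \<longrightarrow> (\<exists>m\<in>\<Lambda>. \<phi> m xs < \<phi> m x + d m x xs))"
proof -
  let ?le = "caristi_le \<Lambda> d \<phi>"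
  let ?A = "{x. ?le x0 x}"
  note refl = caristi_le_refl[of \<Lambda> d, OF assms(2)]
  note trans = caristi_le_trans[of \<Lambda> d, OF assms(2)]
  note antisym = caristi_le_antisym[of \<Lambda> d, OF assms(2,4)]
  have "\<exists>xs\<in>?A. \<forall>x\<in>?A. ?le xs x \<longrightarrow> x = xs"
  \<comment> \<open>Restricting to the points above \<open>x0\<close> builds the first condition
    into the maximal element.\<close>
  proof (rule predicate_Zorn)
    show "partial_order_on ?A (relation_of ?le ?A)"
      by (rule partial_order_on_relation_ofI) (use refl trans antisym in blast)+
  next
    fix C assume "C \<in> Chains (relation_of ?le ?A)"
    then have C: "C \<subseteq> ?A" "\<And>x y. x \<in> C \<Longrightarrow> y \<in> C \<Longrightarrow> ?le x y \<or> ?le y x"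
      by (auto simp: Chains_def relation_of_def)
    show "\<exists>u\<in>?A. \<forall>x\<in>C. ?le x u"
    proof (cases "C = {}")
      \<comment> \<open>The empty chain is bounded by \<open>x0\<close> itself.\<close>
      case True
      then show ?thesis using refl by auto
    next
      case False
      obtain u where u: "\<And>x. x \<in> C \<Longrightarrow> ?le x u"
        using caristi_chain_ub[of \<Lambda> d \<phi> C, OF assms(1,2,4,5,6) False C(2)] by blast
      with False C(1) have "?le x0 u"
        using trans by blast
      with u show ?thesis by blast
    qed
  qed
  \<comment> \<open>Maximality holds in the whole space, since by transitivity any point above
    \<open>xs\<close> is also above \<open>x0\<close>.\<close>
  then obtain xs where xs: "?le x0 xs" and max: "\<And>x. ?le xs x \<Longrightarrow> x = xs"
    using trans by blast
  show ?thesis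
  proof (intro exI conjI ballI allI impI)
    show "\<phi> l xs + d l x0 xs \<le> \<phi> l x0" if "l \<in> \<Lambda>" for l
      using xs that by (rule caristi_leD)
  next
    fix x assume "x \<noteq> xs"
    \<comment> \<open>As \<open>x\<close> is not above \<open>xs\<close>, the defining inequality
      fails for some index \<open>m\<close>; this is the second condition up to symmetry of
      \<open>d m\<close>.\<close>
    with max obtain m where m: "m \<in> \<Lambda>" "\<phi> m xs < \<phi> m x + d m xs x"
      by (force simp: caristi_le_def not_le)
    then show "\<exists>m\<in>\<Lambda>. \<phi> m xs < \<phi> m x + d m x xs"
      using pseudometricD(3)[OF assms(2)[OF m(1)], of xs x] by auto
  qed
qed

end
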